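(* Let $\mathfrak g$ be one of the types $B^{(1)}_n$ $(n\ge3)$, $C^{(1)}_n$ $(n\ge2)$, $D^{(1)}_n$ $(n\ge4)$, $A^{(2)}_{2n}$ $(n\ge1)$, $A^{(2)\dagger}_{2n}$ $(n\ge1)$, $A^{(2)}_{2n-1}$ $(n\ge2)$, $D^{(2)}_{n+1}$ $(n\ge2)$. Let $L\ge0$, let $\lambda\in\mathbb Z^n$ be a dominant weight and let $\nu^\bullet$ be a $\lambda$-configuration for $L$, with vacancy numbers $P_i^{(a)}(\nu^\bullet)$ and with $m_i^{(a)}(\nu^\bullet)$ the multiplicity of $i$ as a part of $\nu^{(a)}$. The following are equivalent: 1. $P_i^{(a)}(\nu^\bullet)\ge0$ for all $a\in\{1,\dots,n\}$ and $i\in\upsilon_a\mathbb Z_{>0}$; 2. $P_i^{(a)}(\nu^\bullet)\ge0$ for all $a\in\{1,\dots,n\}$ and $i\in\upsilon_a\mathbb Z_{>0}$ such that $m_i^{(a)}(\nu^\bullet)>0$.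
   Context: $\lambda\in\mathbb Z^n$ is dominant if $\lambda_1\ge\dots\ge\lambda_n\ge0$ (for $D^{(1)}_n$: $\lambda_1\ge\dots\ge\lambda_n$ and $\lambda_{n-1}+\lambda_n\ge0$). Let $\upsilon_n=2$ for $C^{(1)}_n$, $\upsilon_n=\frac12$ for $B^{(1)}_n$, and $\upsilon_a=1$ in all other cases. $\nu^\bullet=(\nu^{(1)},\dots,\nu^{(n)})$, where $\nu^{(a)}$ is a finite multiset of parts from $\upsilon_a\mathbb Z_{>0}$; $|\nu^{(a)}|$ is the sum of the parts; $Q_i(\tau)=\sum_j\min(\tau_j,i)$ for a multiset $\tau=\{\tau_j\}$. Put $\nu^{(0)}=(1^L)$ ($L$ parts equal to $1$). $\nu^\bullet$ is a $\lambda$-configuration for $L$ if, with $S_a=\lambda_1+\cdots+\lambda_a$: - $C^{(1)}_n,A^{(2)}_{2n},A^{(2)\dagger}_{2n},D^{(2)}_{n+1}$: $|\nu^{(a)}|=L-S_a$ for $1\le a\le n$; - $B^{(1)}_n,A^{(2)}_{2n-1}$: $|\nu^{(a)}|=L-S_a$ for $a<n$, $|\nu^{(n)}|=\frac12(L-S_n)$; - $D^{(1)}_n$: $|\nu^{(a)}|=L-S_a$ for $a\le n-2$, $|\nu^{(n-1)}|=\frac12(L-S_{n-1}+\lambda_n)$, $|\nu^{(n)}|=\frac12(L-S_n)$. Vacancy numbers, for $i\in\upsilon_a\mathbb Z_{>0}$: $P_i^{(a)}(\nu^\bullet)=Q_i(\nu^{(a-1)})-2Q_i(\nu^{(a)})+Q_i(\nu^{(a+1)})$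 except in the following cases: - $D^{(1)}_n$: $P^{(n-2)}_i=Q_i(\nu^{(n-3)})-2Q_i(\nu^{(n-2)})+Q_i(\nu^{(n-1)})+Q_i(\nu^{(n)})$, $P^{(a)}_i=Q_i(\nu^{(n-2)})-2Q_i(\nu^{(a)})$ for $a=n-1,n$; - $B^{(1)}_n$: $P^{(n-1)}_i=Q_i(\nu^{(n-2)})-2Q_i(\nu^{(n-1)})+2Q_i(\nu^{(n)})$, $P^{(n)}_i=2Q_i(\nu^{(n-1)})-4Q_i(\nu^{(n)})$; - $C^{(1)}_n,A^{(2)}_{2n},A^{(2)\dagger}_{2n}$: $P^{(n)}_i=Q_i(\nu^{(n-1)})-Q_i(\nu^{(n)})$; - $A^{(2)}_{2n-1}$: $P^{(n-1)}_i=Q_i(\nu^{(n-2)})-2Q_i(\nu^{(n-1)})+2Q_i(\nu^{(n)})$, $P^{(n)}_i=Q_i(\nu^{(n-1)})-2Q_i(\nu^{(n)})$; - $D^{(2)}_{n+1}$: $P^{(n)}_i=2Q_i(\nu^{(n-1)})-2Q_i(\nu^{(n)})$. *)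

theory Defs
  imports Complex_Main "HOL-Library.Multiset"
begin

text \<open>
  The seven families of non-exceptional affine types; the rank \<open>n\<close> is a separate parameter.
  In order: \<open>B\<^sub>n\<^sup>(\<^sup>1\<^sup>)\<close>, \<open>C\<^sub>n\<^sup>(\<^sup>1\<^sup>)\<close>, \<open>D\<^sub>n\<^sup>(\<^sup>1\<^sup>)\<close>, \<open>A\<^sub>2\<^sub>n\<^sup>(\<^sup>2\<^sup>)\<close>, its dagger variant, \<open>A\<^sub>2\<^sub>n\<^sub>-\<^sub>1\<^sup>(\<^sup>2\<^sup>)\<close> and
  \<open>D\<^sub>n\<^sub>+\<^sub>1\<^sup>(\<^sup>2\<^sup>)\<close>.
\<close>

datatype affine_family = B1 | C1 | D1 | A2even | A2even_dag | A2odd | D2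

fun min_rank :: "affine_family \<Rightarrow> nat" where
  "min_rank B1 = 3"
| "min_rank C1 = 2"
| "min_rank D1 = 4"
| "min_rank A2even = 1"
| "min_rank A2even_dag = 1"
| "min_rank A2odd = 2"
| "min_rank D2 = 2"

text \<open>
  A weight in \<open>\<int>\<^sup>n\<close> is a function \<open>nat \<Rightarrow> int\<close>, and \<open>\<nu>\<^sup>\<bullet>\<close> is a function \<open>nat \<Rightarrow> rat multiset\<close>;
  only the values at \<open>1, \<dots>, n\<close> are ever used.
\<close>

definition dominant :: "affine_family \<Rightarrow> nat \<Rightarrow> (nat \<Rightarrow> int) \<Rightarrow> bool" where
  "dominant t n lam \<longleftrightarrow>
     (\<forall>a. 1 \<le> a \<and> a < n \<longrightarrow> lam (a + 1) \<le> lam a) \<and>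
     (if t = D1 then 0 \<le> lam (n - 1) + lam n else 0 \<le> lam n)"

definition upsilon :: "affine_family \<Rightarrow> nat \<Rightarrow> nat \<Rightarrow> rat" where
  "upsilon t n a =
     (if t = C1 \<and> a = n then 2 else if t = B1 \<and> a = n then 1 / 2 else 1)"

definition part_sizes :: "affine_family \<Rightarrow> nat \<Rightarrow> nat \<Rightarrow> rat set" where
  "part_sizes t n a = {upsilon t n a * of_nat k |k. 0 < k}"

definition Q :: "rat multiset \<Rightarrow> rat \<Rightarrow> rat" where
  "Q \<tau> i = (\<Sum>x\<in>#\<tau>. min x i)"

definition partial_sum :: "(nat \<Rightarrow> int) \<Rightarrow> nat \<Rightarrow> int" where
  "partial_sum lam a = (\<Sum>b = 1..a. lam b)"

fun config_size :: "affine_family \<Rightarrow> nat \<Rightarrow> nat \<Rightarrow> (nat \<Rightarrow> int) \<Rightarrow> nat \<Rightarrow> rat" where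
  "config_size B1 n L lam a =
     (if a = n then (of_nat L - of_int (partial_sum lam n)) / 2
      else of_nat L - of_int (partial_sum lam a))"
| "config_size A2odd n L lam a =
     (if a = n then (of_nat L - of_int (partial_sum lam n)) / 2
      else of_nat L - of_int (partial_sum lam a))"
| "config_size D1 n L lam a =
     (if a = n then (of_nat L - of_int (partial_sum lam n)) / 2
      else if a = n - 1
        then (of_nat L - of_int (partial_sum lam (n - 1)) + of_int (lam n)) / 2
      else of_nat L - of_int (partial_sum lam a))"
| "config_size _ n L lam a = of_nat L - of_int (partial_sum lam a)"

definition is_configuration ::
  "affine_family \<Rightarrow> nat \<Rightarrow> nat \<Rightarrow> (nat \<Rightarrow> int) \<Rightarrow> (nat \<Rightarrow> rat multiset) \<Rightarrow> bool" where
  "is_configuration t n L lam \<nu> \<longleftrightarrow>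
     (\<forall>a\<in>{1..n}. set_mset (\<nu> a) \<subseteq> part_sizes t n a \<and>
                  sum_mset (\<nu> a) = config_size t n L lam a)"

text \<open>\<open>Qa L \<nu> a i\<close> is \<open>Q\<^sub>i\<close> of the \<open>a\<close>-th multiset, where the zeroth one is \<open>(1\<^sup>L)\<close> regardless of
  \<open>\<nu> 0\<close>.\<close>

definition Qa :: "nat \<Rightarrow> (nat \<Rightarrow> rat multiset) \<Rightarrow> nat \<Rightarrow> rat \<Rightarrow> rat" where
  "Qa L \<nu> a i = Q (if a = 0 then replicate_mset L 1 else \<nu> a) i"

text \<open>
  For \<open>1 \<le> a \<le> n\<close>, every family treats the node \<open>a = n\<close> separately, so the generic formula is only
  used for \<open>a < n\<close> and never refers to an \<open>(n+1)\<close>-st multiset.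
\<close>

definition vacancy_generic :: "nat \<Rightarrow> (nat \<Rightarrow> rat multiset) \<Rightarrow> nat \<Rightarrow> rat \<Rightarrow> rat" where
  "vacancy_generic L \<nu> a i = Qa L \<nu> (a - 1) i - 2 * Qa L \<nu> a i + Qa L \<nu> (a + 1) i"

fun vacancy ::
  "affine_family \<Rightarrow> nat \<Rightarrow> nat \<Rightarrow> (nat \<Rightarrow> rat multiset) \<Rightarrow> nat \<Rightarrow> rat \<Rightarrow> rat" where
  "vacancy D1 n L \<nu> a i =
     (if a = n - 2 then
        Qa L \<nu> (n - 3) i - 2 * Qa L \<nu> (n - 2) i + Qa L \<nu> (n - 1) i + Qa L \<nu> n i
      else if a = n - 1 \<or> a = n then Qa L \<nu> (n - 2) i - 2 * Qa L \<nu> a i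
      else vacancy_generic L \<nu> a i)"
| "vacancy B1 n L \<nu> a i =
     (if a = n - 1 then Qa L \<nu> (n - 2) i - 2 * Qa L \<nu> (n - 1) i + 2 * Qa L \<nu> n i
      else if a = n then 2 * Qa L \<nu> (n - 1) i - 4 * Qa L \<nu> n i
      else vacancy_generic L \<nu> a i)"
| "vacancy A2odd n L \<nu> a i =
     (if a = n - 1 then Qa L \<nu> (n - 2) i - 2 * Qa L \<nu> (n - 1) i + 2 * Qa L \<nu> n i
      else if a = n then Qa L \<nu> (n - 1) i - 2 * Qa L \<nu> n i
      else vacancy_generic L \<nu> a i)"
| "vacancy D2 n L \<nu> a i =
     (if a = n then 2 * Qa L \<nu> (n - 1) i - 2 * Qa L \<nu> n i
      else vacancy_generic L \<nu> a i)"
| "vacancy _ n L \<nu> a i =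
     (if a = n then Qa L \<nu> (n - 1) i - Qa L \<nu> n i
      else vacancy_generic L \<nu> a i)"

end

theory Submission
  imports Defs
begin

text \<open>
  As a function of a rational \<open>i \<ge> 0\<close>, each \<open>Q\<^sub>i(\<tau>)\<close> is concave, and it is affine on any interval
  without parts of \<open>\<tau>\<close> in its interior. A vacancy number \<open>P\<^sub>i\<^sup>(\<^sup>a\<^sup>)\<close> has the form
  \<open>Q\<^sub>i(\<sigma>) - c Q\<^sub>i(\<nu>\<^sup>(\<^sup>a\<^sup>))\<close>, so it is concave between consecutive parts of \<open>\<nu>\<^sup>(\<^sup>a\<^sup>)\<close>, and it is
  nonnegative there as soon as it is so at the end points. It vanishes at \<open>i = 0\<close>, and for large \<open>i\<close>
  it is constant, equal to a pairing of the weight with a simple coroot up to a positive factor,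
  which is nonnegative by dominance.
\<close>

lemma Q_union: "Q (\<sigma> + \<tau>) i = Q \<sigma> i + Q \<tau> i"
  by (simp add: Q_def)

lemma Q_0: "(\<And>x. x \<in># \<tau> \<Longrightarrow> 0 \<le> x) \<Longrightarrow> Q \<tau> 0 = 0"
  unfolding Q_def by (induction \<tau>) auto

lemma Q_eq_sum_mset: "(\<And>x. x \<in># \<tau> \<Longrightarrow> x \<le> i) \<Longrightarrow> Q \<tau> i = \<Sum>\<^sub># \<tau>"
  unfolding Q_def by (induction \<tau>) auto

lemma min_concave:
  fixes l i u x :: "'a :: linordered_idom"
  assumes "l \<le> i" "i \<le> u"
  shows "(u - i) * min x l + (i - l) * min x u \<le> (u - l) * min x i"
proof (cases "x \<le> i")
  case True
  have "(u - i) * min x l \<le> (u - i) * x" "(i - l) * min x u \<le> (i - l) * x"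
    using assms by (auto intro!: mult_left_mono)
  then show ?thesis using True by (simp add: algebra_simps)
next
  case False
  have "(i - l) * min x u \<le> (i - l) * u"
    using assms by (auto intro!: mult_left_mono)
  then show ?thesis using False assms by (simp add: algebra_simps)
qed

lemma min_affine:
  fixes l i u x :: "'a :: linordered_idom"
  assumes "l \<le> i" "i \<le> u" "x \<le> l \<or> u \<le> x"
  shows "(u - i) * min x l + (i - l) * min x u = (u - l) * min x i"
proof -
  consider "x \<le> l" | "u \<le> x" "i = u" | "u \<le> x" "i < u" using assms by fastforce
  then show ?thesis using assms by cases (simp_all add: algebra_simps)
qed

lemma Q_concave:
  assumes "l \<le> i" "i \<le> u"
  shows "(u - i) * Q \<tau> l + (i - l) * Q \<tau> u \<le> (u - l) * Q \<tau> i"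
proof (induction \<tau>)
  case (add x \<tau>)
  then show ?case
    using min_concave[OF assms, of x] by (simp add: Q_def distrib_left)
qed (simp add: Q_def)

lemma Q_affine:
  assumes "l \<le> i" "i \<le> u" and "\<And>x. x \<in># \<tau> \<Longrightarrow> x \<le> l \<or> u \<le> x"
  shows "(u - i) * Q \<tau> l + (i - l) * Q \<tau> u = (u - l) * Q \<tau> i"
  using assms(3)
proof (induction \<tau>)
  case (add x \<tau>)
  then show ?case
    using min_affine[OF assms(1,2), of x] by (simp add: Q_def distrib_left)
qed (simp add: Q_def)

lemma Q_diff_nonneg_between:
  assumes "l \<le> i" "i \<le> u" and gap: "\<And>x. x \<in># \<tau> \<Longrightarrow> x \<le> l \<or> u \<le> x"
    and l: "c * Q \<tau> l \<le> Q \<sigma> l" and u: "c * Q \<tau> u \<le> Q \<sigma> u"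
  shows "c * Q \<tau> i \<le> Q \<sigma> i"
proof (cases "l = u")
  case False
  have "(u - l) * (c * Q \<tau> i) = c * ((u - i) * Q \<tau> l + (i - l) * Q \<tau> u)"
    by (simp add: Q_affine[OF assms(1,2) gap])
  also have "\<dots> = (u - i) * (c * Q \<tau> l) + (i - l) * (c * Q \<tau> u)"
    by (simp add: algebra_simps)
  also have "\<dots> \<le> (u - i) * Q \<sigma> l + (i - l) * Q \<sigma> u"
    using assms by (intro add_mono mult_left_mono) auto
  also have "\<dots> \<le> (u - l) * Q \<sigma> i"
    by (rule Q_concave[OF assms(1,2)])
  finally show ?thesis using assms(1,2) False by simp
qed (use assms in auto)

lemma Q_diff_nonneg:
  assumes pos: "\<And>x. x \<in># \<sigma> + \<tau> \<Longrightarrow> 0 \<le> x"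
    and parts: "\<And>x. x \<in># \<tau> \<Longrightarrow> c * Q \<tau> x \<le> Q \<sigma> x"
    and total: "c * \<Sum>\<^sub># \<tau> \<le> \<Sum>\<^sub># \<sigma>"
    and "0 \<le> i"
  shows "c * Q \<tau> i \<le> Q \<sigma> i"
proof -
  define A where "A = insert 0 {x \<in> set_mset \<tau>. x \<le> i}"
  define B where "B = {x \<in> set_mset \<tau>. i < x}"
  define l where "l = Max A"
  define u where "u = (if B = {} then Max (insert i (set_mset (\<sigma> + \<tau>))) else Min B)"
  have fin: "finite A" "finite B" by (auto simp: A_def B_def)
  have "l \<in> A" unfolding l_def using fin by (intro Max_in) (auto simp: A_def)
  have "l \<le> i" using \<open>l \<in> A\<close> \<open>0 \<le> i\<close> by (auto simp: A_def)
  have l: "c * Q \<tau> l \<le> Q \<sigma> l"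
    using \<open>l \<in> A\<close> parts pos by (auto simp: A_def Q_0)
  have below: "x \<le> l" if "x \<in># \<tau>" "x \<le> i" for x
    unfolding l_def using fin that by (intro Max_ge) (auto simp: A_def)
  have "i \<le> u \<and> c * Q \<tau> u \<le> Q \<sigma> u \<and> (\<forall>x \<in># \<tau>. i < x \<longrightarrow> u \<le> x)"
  proof (cases "B = {}")
    case True
    then have "u = Max (insert i (set_mset (\<sigma> + \<tau>)))" by (simp add: u_def)
    then have ge: "x \<le> u" if "x \<in> insert i (set_mset (\<sigma> + \<tau>))" for x
      using that by (metis Max_ge finite_insert finite_set_mset)
    have "Q \<tau> u = \<Sum>\<^sub># \<tau>" "Q \<sigma> u = \<Sum>\<^sub># \<sigma>"
      by (rule Q_eq_sum_mset, simp add: ge)+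
    with ge total True show ?thesis by (auto simp: B_def)
  next
    case False
    then have u: "u = Min B" by (simp add: u_def)
    then have "u \<in> B" using False fin by simp
    moreover have "u \<le> x" if "x \<in> B" for x using that fin u by simp
    ultimately show ?thesis using parts by (auto simp: B_def)
  qed
  with \<open>l \<le> i\<close> l below show ?thesis
    by (intro Q_diff_nonneg_between[of l i u]) (use not_le in blast)+
qed

lemma partial_sum_0 [simp]: "partial_sum lam 0 = 0"
  by (simp add: partial_sum_def)

lemma partial_sum_Suc [simp]: "partial_sum lam (Suc a) = partial_sum lam a + lam (Suc a)"
  by (simp add: partial_sum_def)

lemma vacancy_decomposition:
  assumes rank: "min_rank t \<le> n" and dom: "dominant t n lam"
    and conf: "is_configuration t n L lam \<nu>" and a: "a \<in> {1..n}"
  obtains \<sigma> c where "\<And>x. x \<in># \<sigma> \<Longrightarrow> 0 \<le> x"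
    and "\<And>i. vacancy t n L \<nu> a i = Q \<sigma> i - c * Q (\<nu> a) i"
    and "c * \<Sum>\<^sub># (\<nu> a) \<le> \<Sum>\<^sub># \<sigma>"
proof -
  define N where "N b = (if b = 0 then replicate_mset L 1 else \<nu> b)" for b
  define size where "size b = (if b = 0 then of_nat L else config_size t n L lam b)" for b
  have Qa: "Qa L \<nu> b i = Q (N b) i" for b i
    by (simp add: Qa_def N_def)
  have nonneg: "0 \<le> x" if "x \<in># N b" "b \<le> n" for b x
  proof (cases "b = 0")
    case False
    then have "x \<in> part_sizes t n b"
      using conf that by (fastforce simp: is_configuration_def N_def)
    then show ?thesis by (auto simp: part_sizes_def upsilon_def)
  qed (use that in \<open>auto simp: N_def split: if_splits\<close>)
  have sum_N: "\<Sum>\<^sub># (N b) = size b" if "b \<le> n" for b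
    using conf that by (auto simp: is_configuration_def N_def size_def)
  have Na: "N a = \<nu> a" using a by (simp add: N_def)
  have lam_step: "rat_of_int (lam (Suc b)) \<le> of_int (lam b)" if "1 \<le> b" "b < n" for b
    using dom that by (simp add: dominant_def)
  have lam_n: "0 \<le> rat_of_int (lam n)" if "t \<noteq> D1"
    using dom that by (simp add: dominant_def)
  have lam_n_D1: "0 \<le> rat_of_int (lam (n - 1)) + of_int (lam n)" if "t = D1"
    using dom that by (simp add: dominant_def flip: of_int_add)
  have size: "size b = of_nat L - of_int (partial_sum lam b)"
    if "b < n" "t = D1 \<longrightarrow> b \<noteq> n - 1" for b
    using that by (cases t) (auto simp: size_def)
  have size_n: "size n = config_size t n L lam n"
    using a by (simp add: size_def)
  let ?P = "\<exists>\<sigma> c. (\<forall>x \<in># \<sigma>. 0 \<le> x) \<and> (\<forall>i. vacancy t n L \<nu> a i = Q \<sigma> i - c * Q (N a) i)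
      \<and> c * \<Sum>\<^sub># (N a) \<le> \<Sum>\<^sub># \<sigma>"
  have witness: ?P
    if le: "\<forall>b \<in> set bs. b \<le> n"
      and vac: "\<And>i. vacancy t n L \<nu> a i = (\<Sum>b\<leftarrow>bs. Q (N b) i) - c * Q (N a) i"
      and total: "c * size a \<le> (\<Sum>b\<leftarrow>bs. size b)" for bs c
  proof -
    have "\<forall>x \<in># \<Sum>b\<leftarrow>bs. N b. 0 \<le> x"
      using le nonneg by (induction bs) auto
    moreover have "Q (\<Sum>b\<leftarrow>bs. N b) i = (\<Sum>b\<leftarrow>bs. Q (N b) i)" for i
      by (induction bs) (simp_all add: Q_union, simp add: Q_def)
    moreover have "\<Sum>\<^sub># (\<Sum>b\<leftarrow>bs. N b) = (\<Sum>b\<leftarrow>bs. size b)"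
      using le by (induction bs) (simp_all add: sum_N)
    ultimately show ?P
      using vac total sum_N[of a] a by (intro exI[of _ "\<Sum>b\<leftarrow>bs. N b"] exI[of _ c]) auto
  qed
  consider (last) "a = n" | (spin) "a = n - 1" "a < n" "t = D1"
    | (fork) "a = n - 2" "t = D1"
    | (double) "a = n - 1" "a < n" "t = B1 \<or> t = A2odd"
    | (generic) "a < n" "t = D1 \<Longrightarrow> a < n - 2" "t = B1 \<or> t = A2odd \<Longrightarrow> a < n - 1"
    using a by fastforce
  then have ?P
  proof cases
    case last
    then obtain m where m: "n = Suc m" using a by (cases n) auto
    show ?thesis
    proof (cases t)
      case B1
      show ?thesis
        by (rule witness[of "[m, m]" 4])
          (use last m B1 lam_n size_n in \<open>auto simp: Qa size\<close>)
    next
      case A2odd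
      show ?thesis
        by (rule witness[of "[m]" 2])
          (use last m A2odd lam_n rank size_n in \<open>auto simp: Qa size\<close>)
    next
      case D2
      show ?thesis
        by (rule witness[of "[m, m]" 2])
          (use last m D2 lam_n size_n in \<open>auto simp: Qa size\<close>)
    next
      case D1
      then obtain k where k: "n = Suc (Suc k)"
        using rank by (cases n; cases "n - 1") auto
      show ?thesis
        by (rule witness[of "[k]" 2])
          (use last k D1 lam_n_D1 size_n in \<open>auto simp: Qa size\<close>)
    qed (rule witness[of "[m]" 1];
        use last m lam_n size_n in \<open>auto simp: Qa size\<close>)+
  next
    case spin
    then obtain k where k: "n = Suc (Suc k)" using a by (cases n; cases "n - 1") auto
    show ?thesis
      by (rule witness[of "[k]" 2])
        (use spin k lam_step[of a] a in \<open>auto simp: Qa size, auto simp: size_def\<close>)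
  next
    case fork
    then obtain k where k: "n = Suc (Suc (Suc k))"
      using a by (cases n; cases "n - 1"; cases "n - 2") auto
    show ?thesis
      by (rule witness[of "[k, k + 2, n]" 2])
        (use fork k lam_step[of a] size_n in \<open>auto simp: Qa size, auto simp: size_def field_simps\<close>)
  next
    case double
    then obtain k where k: "n = Suc (Suc k)" using a by (cases n; cases "n - 1") auto
    show ?thesis
      by (rule witness[of "[k, n, n]" 2])
        (use double k lam_step[of a] size_n in \<open>auto simp: Qa size field_simps\<close>)
  next
    case generic
    then obtain m where m: "a = Suc m" using a by (cases a) auto
    show ?thesis
    proof (rule witness[of "[m, Suc a]" 2])
      show "vacancy t n L \<nu> a i = (\<Sum>b\<leftarrow>[m, Suc a]. Q (N b) i) - 2 * Q (N a) i" for i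
        using generic m by (cases t) (auto simp: vacancy_generic_def Qa)
      have "size b = of_nat L - of_int (partial_sum lam b)" if "b \<le> Suc a" for b
        using generic that by (cases t) (auto simp: size_def)
      then show "2 * size a \<le> (\<Sum>b\<leftarrow>[m, Suc a]. size b)"
        using generic(1) m lam_step[of a] by auto
    qed (use generic m in auto)
  qed
  then show thesis using that unfolding Na by blast
qed

theorem lemma5p3:
  fixes t :: affine_family and n L :: nat
    and lam :: "nat \<Rightarrow> int" and \<nu> :: "nat \<Rightarrow> rat multiset"
  assumes "min_rank t \<le> n"
    and "dominant t n lam"
    and "is_configuration t n L lam \<nu>"
  shows "(\<forall>a\<in>{1..n}. \<forall>i\<in>part_sizes t n a. 0 \<le> vacancy t n L \<nu> a i) \<longleftrightarrow>
         (\<forall>a\<in>{1..n}. \<forall>i\<in>part_sizes t n a.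
            0 < count (\<nu> a) i \<longrightarrow> 0 \<le> vacancy t n L \<nu> a i)"
proof (intro iffI ballI)
  fix a i
  assume parts: "\<forall>a\<in>{1..n}. \<forall>i\<in>part_sizes t n a.
      0 < count (\<nu> a) i \<longrightarrow> 0 \<le> vacancy t n L \<nu> a i"
    and a: "a \<in> {1..n}" and i: "i \<in> part_sizes t n a"
  have nonneg: "0 \<le> x" if "x \<in> part_sizes t n a" for x
    using that by (auto simp: part_sizes_def upsilon_def)
  have mem: "x \<in> part_sizes t n a" if "x \<in># \<nu> a" for x
    using assms(3) a that by (auto simp: is_configuration_def)
  obtain \<sigma> c where \<sigma>: "\<And>x. x \<in># \<sigma> \<Longrightarrow> 0 \<le> x"
    and vac: "\<And>i. vacancy t n L \<nu> a i = Q \<sigma> i - c * Q (\<nu> a) i"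
    and total: "c * \<Sum>\<^sub># (\<nu> a) \<le> \<Sum>\<^sub># \<sigma>"
    using vacancy_decomposition[OF assms a] by metis
  have "c * Q (\<nu> a) i \<le> Q \<sigma> i"
  proof (rule Q_diff_nonneg[OF _ _ total])
    show "0 \<le> x" if "x \<in># \<sigma> + \<nu> a" for x
      using that \<sigma> nonneg mem by auto
    show "c * Q (\<nu> a) x \<le> Q \<sigma> x" if "x \<in># \<nu> a" for x
      using parts[rule_format, OF a mem[OF that]] that by (simp add: vac)
  qed (use nonneg i in auto)
  then show "0 \<le> vacancy t n L \<nu> a i" by (simp add: vac)
qed blast

end
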